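(* A nonzero Banach space $X$ is almost square (ASQ) if and only if $X$ $\varepsilon$-fails the intersection property for all $0<\varepsilon<1$.
   Context: All Banach spaces are real. $S_X$ and $B_X$ denote the unit sphere and closed unit ball of $X$. A Banach space $X$ is almost square (ASQ) if for every finite subset $(x_i)_{i=1}^N \subset S_X$ there exists a sequence $(y_n)\subset B_X$ such that $\|x_i\pm y_n\|\to 1$ for every $i=1,\ldots,N$ and $\|y_n\|\to 1$. For $0<\varepsilon<1$, put $$\gamma(\varepsilon)=\sup_{x_1,\ldots,x_n}\ \inf_{y}\ \max_{i}\|x_i-y\|,$$ where the supremum is over all finite families $x_1,\ldots,x_n\in X$ with $\|x_i\|<1$ for all $i$, and the infimum is over all $y\in X$ with $\varepsilon<\|y\|\le 1$. $X$ is said to $\varepsilon$-fail the intersection property if $\gamma(\varepsilon)=1$. *)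

theory Defs
  imports "HOL-Analysis.Analysis"
begin

text \<open>A real Banach space is a type of class \<open>banach\<close>; properties of the whole space take an
  \<open>itself\<close> argument.\<close>

definition almost_square :: "'a::banach itself \<Rightarrow> bool" where
  "almost_square (_ :: 'a itself) \<longleftrightarrow>
    (\<forall>A \<subseteq> sphere (0::'a) 1. finite A \<longrightarrow>
      (\<exists>y :: nat \<Rightarrow> 'a. range y \<subseteq> cball 0 1 \<and>
        (\<forall>x\<in>A. (\<lambda>n. norm (x + y n)) \<longlonglongrightarrow> 1 \<and> (\<lambda>n. norm (x - y n)) \<longlonglongrightarrow> 1) \<and>
        (\<lambda>n. norm (y n)) \<longlonglongrightarrow> 1))"

text \<open>Finite families enter the maximum only through the set of their members, and they are nonempty
  so that the maximum makes sense. In a nonzero space with \<open>0 < \<epsilon> < 1\<close> all the sets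
  involved are nonempty and the values lie in \<open>[0, 2]\<close>, so the real-valued supremum and
  infimum are the genuine ones.\<close>

definition intersection_gamma :: "'a::banach itself \<Rightarrow> real \<Rightarrow> real" where
  "intersection_gamma (_ :: 'a itself) \<epsilon> =
    (SUP A \<in> {A :: 'a set. finite A \<and> A \<noteq> {} \<and> (\<forall>x\<in>A. norm x < 1)}.
      INF y \<in> {y. \<epsilon> < norm y \<and> norm y \<le> 1}.
        Max ((\<lambda>x. norm (x - y)) ` A))"

definition eps_fails_intersection_property :: "'a::banach itself \<Rightarrow> real \<Rightarrow> bool" where
  "eps_fails_intersection_property X \<epsilon> \<longleftrightarrow> intersection_gamma X \<epsilon> = 1"

end

theory Submission
  imports Defs "HOL-Real_Asymp.Real_Asymp"
begin

text \<open>In any nonzero space \<open>\<gamma>(\<epsilon>) \<ge> 1\<close>, because one of \<open>\<parallel>tu - y\<parallel>\<close>, \<open>\<parallel>-tu - y\<parallel>\<close> is at least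
  \<open>t\<close> for every unit vector \<open>u\<close>. Hence \<open>\<epsilon>\<close>-failing means that each finite family in the open unit ball
  admits \<open>y\<close> with \<open>\<epsilon> < \<parallel>y\<parallel> \<le> 1\<close> and \<open>\<parallel>x - y\<parallel> < 1 + \<delta>\<close> throughout the family. An almost
  square space has such \<open>y\<close>: normalise the family and use that \<open>x - y\<close> is the convex combination of
  \<open>x / \<parallel>x\<parallel> - y\<close> and \<open>-y\<close> with weight \<open>\<parallel>x\<parallel>\<close>. Conversely, shrink the points \<open>\<plusminus>x\<close> of the sphere slightly;
  the resulting upper bounds on \<open>\<parallel>x \<plusminus> y\<parallel>\<close> imply lower bounds, as
  \<open>\<parallel>x + y\<parallel> + \<parallel>x - y\<parallel> \<ge> 2\<parallel>x\<parallel>\<close>.\<close>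

lemma norm_double_le_add_diff:
  fixes x y :: "'a::real_normed_vector"
  shows "2 * norm x \<le> norm (x + y) + norm (x - y)"
proof -
  have "2 * norm x = norm ((x + y) + (x - y))"
    by (simp flip: scaleR_2)
  also have "\<dots> \<le> norm (x + y) + norm (x - y)"
    by (rule norm_triangle_ineq)
  finally show ?thesis .
qed

lemma ex_norm_eq_1:
  assumes "\<exists>x :: 'a::real_normed_vector. x \<noteq> 0"
  obtains u :: "'a::real_normed_vector" where "norm u = 1"
  using assms norm_sgn by metis

text \<open>Trades the nested supremum and infimum for a statement with quantifiers only.
  Boundedness and nonemptiness are checked first, so that \<open>SUP\<close> and \<open>INF\<close>
  have their genuine values.\<close>

lemma eps_fails_iff:
  fixes \<epsilon> :: real
  assumes nz: "\<exists>x :: 'a::banach. x \<noteq> 0" and e: "\<epsilon> < 1"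
  shows "eps_fails_intersection_property TYPE('a) \<epsilon> \<longleftrightarrow>
    (\<forall>A :: 'a set. \<forall>\<delta>>0. finite A \<and> A \<noteq> {} \<and> (\<forall>x\<in>A. norm x < 1) \<longrightarrow>
      (\<exists>y. \<epsilon> < norm y \<and> norm y \<le> 1 \<and> (\<forall>x\<in>A. norm (x - y) < 1 + \<delta>)))"
    (is "_ \<longleftrightarrow> ?R")
proof -
  define F where "F = {A :: 'a set. finite A \<and> A \<noteq> {} \<and> (\<forall>x\<in>A. norm x < 1)}"
  define Y where "Y = {y :: 'a. \<epsilon> < norm y \<and> norm y \<le> 1}"
  define m where "m = (\<lambda>A (y::'a). Max ((\<lambda>x. norm (x - y)) ` A))"
  obtain u :: 'a where u: "norm u = 1"
    using ex_norm_eq_1[OF nz] .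
  have uY: "u \<in> Y"
    using u e by (simp add: Y_def)
  have m_le: "m A y \<le> c \<longleftrightarrow> (\<forall>x\<in>A. norm (x - y) \<le> c)"
    and m_less: "m A y < c \<longleftrightarrow> (\<forall>x\<in>A. norm (x - y) < c)" if "A \<in> F" for A y c
    using that by (auto simp: m_def F_def)
  have m_ge0: "0 \<le> m A y" if "A \<in> F" for A y
  proof -
    obtain x where "x \<in> A" using \<open>A \<in> F\<close> by (auto simp: F_def)
    then have "norm (x - y) \<le> m A y" using m_le[OF that] by blast
    then show ?thesis using norm_ge_zero order_trans by blast
  qed
  have bdd_m: "bdd_below (m A ` Y)" if "A \<in> F" for A
    using m_ge0[OF that] by (intro bdd_belowI[of _ 0]) auto
  \<comment> \<open>The witness \<open>u\<close> is at distance at most 2 from each point of the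
    unit ball; this bound is uniform in \<open>A\<close>, so the supremum over \<open>F\<close> is
    finite.\<close>
  have INF_le_2: "(INF y\<in>Y. m A y) \<le> 2" if "A \<in> F" for A
  proof -
    have "m A u \<le> 2"
      unfolding m_le[OF that]
    proof
      fix x assume "x \<in> A"
      then have "norm x < 1" using that by (simp add: F_def)
      then show "norm (x - u) \<le> 2"
        using norm_triangle_ineq4[of x u] u by linarith
    qed
    then show ?thesis
      using cINF_lower[OF bdd_m[OF that] uY] by linarith
  qed
  then have bdd: "bdd_above ((\<lambda>A. INF y\<in>Y. m A y) ` F)"
    by (intro bdd_aboveI[of _ 2]) auto
  have gamma: "intersection_gamma TYPE('a) \<epsilon> = (SUP A\<in>F. INF y\<in>Y. m A y)"
    by (simp add: intersection_gamma_def F_def Y_def m_def)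
  have ge1: "1 \<le> intersection_gamma TYPE('a) \<epsilon>"
  \<comment> \<open>Members of \<open>F\<close> lie in the open ball, so the pair \<open>u\<close>,
    \<open>-u\<close> is replaced by its multiples by \<open>t\<close>, for all \<open>t\<close>
    below 1.\<close>
  proof (rule dense_le_bounded[of 0])
    fix t :: real assume t: "0 < t" "t < 1"
    let ?A = "{t *\<^sub>R u, - (t *\<^sub>R u)}"
    have A: "?A \<in> F"
      using t u by (simp add: F_def)
    have "t \<le> m ?A y" for y
    proof (rule ccontr)
      assume "\<not> t \<le> m ?A y"
      then have "norm (t *\<^sub>R u - y) < t" "norm (- (t *\<^sub>R u) - y) < t"
        using m_less[OF A] by (auto simp: not_le)
      moreover have "norm (- (t *\<^sub>R u) - y) = norm (t *\<^sub>R u + y)"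
        by (metis norm_minus_cancel minus_diff_eq add.commute diff_minus_eq_add)
      ultimately show False
        using norm_double_le_add_diff[of "t *\<^sub>R u" y] t u by simp
    qed
    then have "t \<le> (INF y\<in>Y. m ?A y)"
      using uY by (intro cINF_greatest) auto
    also have "\<dots> \<le> intersection_gamma TYPE('a) \<epsilon>"
      unfolding gamma using cSUP_upper[OF A bdd] by simp
    finally show "t \<le> intersection_gamma TYPE('a) \<epsilon>" .
  qed simp
  have "F \<noteq> {}"
    by (auto simp: F_def intro: exI[of _ "{0}"])
  then have "eps_fails_intersection_property TYPE('a) \<epsilon> \<longleftrightarrow> (\<forall>A\<in>F. (INF y\<in>Y. m A y) \<le> 1)"
    using ge1 cSUP_le_iff[OF _ bdd, of 1]
    by (simp only: eps_fails_intersection_property_def gamma eq_iff simp_thms not_False_eq_True)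
  also have "\<dots> \<longleftrightarrow> (\<forall>A\<in>F. \<forall>\<delta>>0. \<exists>y\<in>Y. m A y < 1 + \<delta>)"
  proof (rule ball_cong[OF refl])
    fix A assume A: "A \<in> F"
    have "(INF y\<in>Y. m A y) < c \<longleftrightarrow> (\<exists>y\<in>Y. m A y < c)" for c
      using uY bdd_m[OF A] by (subst cINF_less_iff) auto
    \<comment> \<open>The infimum may not be attained; the slack \<delta> gives a strict inequality,
      which some \<open>y\<close> must witness.\<close>
    moreover have "(INF y\<in>Y. m A y) \<le> 1 \<longleftrightarrow> (\<forall>\<delta>>0. (INF y\<in>Y. m A y) < 1 + \<delta>)"
      by (auto intro: field_le_epsilon less_imp_le)
    ultimately show "(INF y\<in>Y. m A y) \<le> 1 \<longleftrightarrow> (\<forall>\<delta>>0. \<exists>y\<in>Y. m A y < 1 + \<delta>)"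
      by simp
  qed
  also have "\<dots> \<longleftrightarrow> (\<forall>A\<in>F. \<forall>\<delta>>0. \<exists>y\<in>Y. \<forall>x\<in>A. norm (x - y) < 1 + \<delta>)"
    using m_less by simp
  also have "\<dots> \<longleftrightarrow> ?R"
    unfolding F_def Y_def by blast
  finally show ?thesis .
qed

lemma norm_diff_le_sgn_convex:
  fixes x y :: "'a::real_normed_vector"
  assumes "norm x \<le> 1"
  shows "norm (x - y) \<le> norm x * norm (sgn x - y) + (1 - norm x) * norm y"
proof -
  have "x - y = norm x *\<^sub>R (sgn x - y) - (1 - norm x) *\<^sub>R y"
    by (cases "x = 0") (simp_all add: sgn_div_norm algebra_simps)
  then show ?thesis
    using norm_triangle_ineq4[of "norm x *\<^sub>R (sgn x - y)" "(1 - norm x) *\<^sub>R y"] assms by simp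
qed

lemma almost_square_imp_eps_fails:
  assumes nz: "\<exists>x :: 'a::banach. x \<noteq> 0" and asq: "almost_square TYPE('a)" and e: "\<epsilon> < 1"
  shows "eps_fails_intersection_property TYPE('a) \<epsilon>"
  unfolding eps_fails_iff[OF nz e]
proof (intro allI impI; elim conjE)
  fix A :: "'a set" and \<delta> :: real
  assume \<delta>: "\<delta> > 0" and A: "finite A" "\<forall>x\<in>A. norm x < 1"
  \<comment> \<open>The point 0 has no normalisation; for it the bound follows from
    \<open>norm (y n) \<le> 1\<close> alone.\<close>
  have "sgn ` (A - {0}) \<subseteq> sphere 0 1"
    by (auto simp: norm_sgn split: if_splits)
  moreover have "finite (sgn ` (A - {0}))"
    using A(1) by simp
  ultimately obtain y :: "nat \<Rightarrow> 'a" where "range y \<subseteq> cball 0 1"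
    and lim: "\<forall>x \<in> sgn ` (A - {0}). (\<lambda>n. norm (x + y n)) \<longlonglongrightarrow> 1 \<and> (\<lambda>n. norm (x - y n)) \<longlonglongrightarrow> 1"
    and lim1: "(\<lambda>n. norm (y n)) \<longlonglongrightarrow> 1"
    using asq unfolding almost_square_def by meson
  then have y: "norm (y n) \<le> 1" for n
    by (meson mem_cball_0 range_subsetD)
  have "\<forall>\<^sub>F n in sequentially. norm (x - y n) < 1 + \<delta>" if x: "x \<in> A" for x
  proof (cases "x = 0")
    case True
    have "norm (y n) < 1 + \<delta>" for n
      using y[of n] \<delta> by simp
    with True show ?thesis by simp
  next
    case False
    have "(\<lambda>n. norm x * norm (sgn x - y n) + (1 - norm x) * norm (y n))
        \<longlonglongrightarrow> norm x * 1 + (1 - norm x) * 1"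
      using lim x False lim1 by (intro tendsto_intros) auto
    then have "\<forall>\<^sub>F n in sequentially. norm x * norm (sgn x - y n) + (1 - norm x) * norm (y n) < 1 + \<delta>"
      using \<delta> by (intro order_tendstoD(2)) auto
    then show ?thesis
      by (rule eventually_mono) (use norm_diff_le_sgn_convex A(2) x in \<open>meson less_imp_le order_le_less_trans\<close>)
  qed
  \<comment> \<open>Finiteness of \<open>A\<close> lets a single index serve all its points.\<close>
  then have "\<forall>\<^sub>F n in sequentially. \<forall>x\<in>A. norm (x - y n) < 1 + \<delta>"
    by (simp add: eventually_ball_finite_distrib[OF A(1)])
  moreover have "\<forall>\<^sub>F n in sequentially. \<epsilon> < norm (y n)"
    using lim1 e by (rule order_tendstoD(1))
  ultimately have "\<forall>\<^sub>F n in sequentially. \<epsilon> < norm (y n) \<and> (\<forall>x\<in>A. norm (x - y n) < 1 + \<delta>)"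
    by eventually_elim auto
  then show "\<exists>y. \<epsilon> < norm y \<and> norm y \<le> 1 \<and> (\<forall>x\<in>A. norm (x - y) < 1 + \<delta>)"
    using y eventually_happens'[OF sequentially_bot] by blast
qed

lemma eps_fails_imp_almost_square:
  assumes nz: "\<exists>x :: 'a::banach. x \<noteq> 0"
    and fails: "\<And>\<epsilon>. 0 < \<epsilon> \<Longrightarrow> \<epsilon> < 1 \<Longrightarrow> eps_fails_intersection_property TYPE('a) \<epsilon>"
  shows "almost_square TYPE('a)"
  unfolding almost_square_def
proof (intro allI impI)
  fix A :: "'a set" assume A: "A \<subseteq> sphere 0 1" "finite A"
  \<comment> \<open>\<open>d n\<close> is at once the gap 1 - \<epsilon>, the amount of shrinking
    and the slack \<delta>. The summand 2 keeps \<epsilon> positive already at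
    \<open>n = 0\<close>.\<close>
  define d where "d n = 1 / (real n + 2)" for n
  have d: "0 < d n" "d n < 1" for n
    by (simp_all add: d_def)
  have "\<exists>y. 1 - d n < norm y \<and> norm y \<le> 1 \<and>
      (\<forall>x\<in>A. norm (x - y) \<le> 1 + 2 * d n \<and> norm (x + y) \<le> 1 + 2 * d n)" for n
  proof -
    let ?f = "\<lambda>x::'a. (1 - d n) *\<^sub>R x"
    \<comment> \<open>\<open>0\<close> is added only to keep the family nonempty.\<close>
    let ?B = "insert 0 (?f ` (A \<union> uminus ` A))"
    have "eps_fails_intersection_property TYPE('a) (1 - d n)"
      using d[of n] by (intro fails) auto
    moreover have "finite ?B" "?B \<noteq> {}" "\<forall>x\<in>?B. norm x < 1"
      using A d[of n] by auto
    moreover have "1 - d n < 1"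
      using d(1) by simp
    ultimately obtain y where y: "1 - d n < norm y" "norm y \<le> 1"
      and B: "\<And>x. x \<in> ?B \<Longrightarrow> norm (x - y) < 1 + d n"
      using eps_fails_iff[OF nz, of "1 - d n"] d(1)[of n] by meson
    \<comment> \<open>One \<open>d n\<close> is the slack at the shrunk point \<open>?f z\<close>,
      the other is the distance from \<open>?f z\<close> back to \<open>z\<close>. Negatives are
      included because \<open>- x - y\<close> has the norm of \<open>x + y\<close>.\<close>
    have *: "norm (z - y) \<le> 1 + 2 * d n" if z: "z \<in> A \<union> uminus ` A" for z
    proof -
      have "norm z = 1"
        using z A by auto
      moreover have "norm (?f z - y) < 1 + d n"
        using z by (intro B) blast
      moreover have "norm (z - y) \<le> norm (?f z - y) + norm (d n *\<^sub>R z)"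
        using norm_triangle_ineq[of "?f z - y" "d n *\<^sub>R z"] by (simp add: algebra_simps)
      ultimately show ?thesis
        using d[of n] by simp
    qed
    have "norm (x + y) \<le> 1 + 2 * d n" if "x \<in> A" for x
      using *[of "- x"] that norm_minus_cancel[of "x + y"] by simp
    with * y show ?thesis by blast
  qed
  then obtain y where y: "\<And>n. 1 - d n < norm (y n)" "\<And>n. norm (y n) \<le> 1"
    and le: "\<And>n x. x \<in> A \<Longrightarrow> norm (x - y n) \<le> 1 + 2 * d n"
      "\<And>n x. x \<in> A \<Longrightarrow> norm (x + y n) \<le> 1 + 2 * d n"
    by metis
  have d0: "d \<longlonglongrightarrow> 0"
    unfolding d_def by real_asymp
  have lim1: "(\<lambda>n. 1 - d n) \<longlonglongrightarrow> 1" "(\<lambda>n. 1 - 2 * d n) \<longlonglongrightarrow> 1" "(\<lambda>n. 1 + 2 * d n) \<longlonglongrightarrow> 1"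
    using tendsto_diff[OF tendsto_const d0, of 1]
      tendsto_diff[OF tendsto_const tendsto_mult_right[OF d0], of 1 2]
      tendsto_add[OF tendsto_const tendsto_mult_right[OF d0], of 1 2] by (simp_all add: mult.commute)
  have "(\<lambda>n. norm (x + y n)) \<longlonglongrightarrow> 1 \<and> (\<lambda>n. norm (x - y n)) \<longlonglongrightarrow> 1" if x: "x \<in> A" for x
  proof -
    have "norm x = 1"
      using x A by auto
    \<comment> \<open>The two norms sum to at least 2 and each is at most
      \<open>1 + 2 * d n\<close>, so each is at least the difference.\<close>
    then have "1 - 2 * d n \<le> norm (x + y n)" "1 - 2 * d n \<le> norm (x - y n)" for n
      using norm_double_le_add_diff[of x "y n"] le[OF x, of n] by linarith+
    then show ?thesis
      using le[OF x] by (auto intro!: tendsto_sandwich[OF _ _ lim1(2,3)])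
  qed
  moreover have "(\<lambda>n. norm (y n)) \<longlonglongrightarrow> 1"
    using y by (intro tendsto_sandwich[OF _ _ lim1(1) tendsto_const]) (simp_all add: less_imp_le)
  moreover have "range y \<subseteq> cball 0 1"
    using y by auto
  ultimately show "\<exists>y :: nat \<Rightarrow> 'a. range y \<subseteq> cball 0 1 \<and>
      (\<forall>x\<in>A. (\<lambda>n. norm (x + y n)) \<longlonglongrightarrow> 1 \<and> (\<lambda>n. norm (x - y n)) \<longlonglongrightarrow> 1) \<and>
      (\<lambda>n. norm (y n)) \<longlonglongrightarrow> 1"
    by blast
qed

theorem proposition6p1:
  assumes "\<exists>x :: 'a::banach. x \<noteq> 0"
  shows "almost_square TYPE('a) \<longleftrightarrow>
    (\<forall>\<epsilon>::real. 0 < \<epsilon> \<and> \<epsilon> < 1 \<longrightarrow> eps_fails_intersection_property TYPE('a) \<epsilon>)"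
  using almost_square_imp_eps_fails[OF assms] eps_fails_imp_almost_square[OF assms] by blast

end
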